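(* As $n \to \infty$, $$ c'_{n,3} \ \ge\ \left(2\sqrt{\frac{9}{4\pi}} - o(1)\right) \frac{3^n}{\sqrt{n}}.$$
   Context: $[3]^n = \{1,2,3\}^n \subset \mathbb{Z}^n$. A geometric line in $[3]^n$ is any set of the form $\{a+r, a+2r, a+3r\}\subset[3]^n$ with $a, r \in \mathbb{Z}^n$, $r \ne 0$. A Moser set is a subset of $[3]^n$ containing no geometric line. $c'_{n,3}$ denotes the maximum cardinality of a Moser set in $[3]^n$. *)

theory Defs
  imports Complex_Main "HOL-Library.FuncSet" "HOL-Library.Landau_Symbols"
begin

(* The lattice Z^n: the dimension n varies in the statement, so points are integer
   functions on the index set {1..n}, extensional (i.e. undefined) outside of it. *)

definition lattice_points :: "nat \<Rightarrow> (nat \<Rightarrow> int) set" where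
  "lattice_points n = {1..n} \<rightarrow>\<^sub>E UNIV"

definition cube3 :: "nat \<Rightarrow> (nat \<Rightarrow> int) set" where
  "cube3 n = {1..n} \<rightarrow>\<^sub>E {1, 2, 3}"

definition zero_point :: "nat \<Rightarrow> nat \<Rightarrow> int" where
  "zero_point n = (\<lambda>i\<in>{1..n}. 0)"

(* the point a + t r of Z^n *)
definition line_point :: "nat \<Rightarrow> (nat \<Rightarrow> int) \<Rightarrow> (nat \<Rightarrow> int) \<Rightarrow> int \<Rightarrow> nat \<Rightarrow> int" where
  "line_point n a r t = (\<lambda>i\<in>{1..n}. a i + t * r i)"

definition geometric_line :: "nat \<Rightarrow> (nat \<Rightarrow> int) set \<Rightarrow> bool" where
  "geometric_line n L \<longleftrightarrow>
     (\<exists>a\<in>lattice_points n. \<exists>r\<in>lattice_points n. r \<noteq> zero_point n \<and>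
        L = {line_point n a r 1, line_point n a r 2, line_point n a r 3} \<and> L \<subseteq> cube3 n)"

definition moser_set :: "nat \<Rightarrow> (nat \<Rightarrow> int) set \<Rightarrow> bool" where
  "moser_set n S \<longleftrightarrow> S \<subseteq> cube3 n \<and> \<not> (\<exists>L. geometric_line n L \<and> L \<subseteq> S)"

definition moser_number :: "nat \<Rightarrow> nat" where
  "moser_number n = Max (card ` {S. moser_set n S})"

(* The maximum is over a finite nonempty set, hence attained. *)
lemma moser_number_attained: "\<exists>S. moser_set n S \<and> card S = moser_number n"
proof -
  have "finite (cube3 n)"
    unfolding cube3_def by (intro finite_PiE) auto
  then have "finite {S. moser_set n S}"
    by (rule_tac finite_subset[of _ "Pow (cube3 n)"]) (auto simp: moser_set_def)
  moreover have "moser_set n {}"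
    by (auto simp: moser_set_def geometric_line_def)
  ultimately have "moser_number n \<in> card ` {S. moser_set n S}"
    unfolding moser_number_def by (intro Max_in) auto
  then show ?thesis by auto
qed

end

theory Submission
  imports Defs "HOL-Analysis.Analysis" "HOL-Real_Asymp.Real_Asymp"
begin

text \<open>
  Subtracting 2 from every coordinate turns the cube into \<open>{-1, 0, 1}\<^sup>n\<close>. Classify a point by its
  \<^emph>\<open>weight\<close> (the number of nonzero coordinates) and its \<^emph>\<open>skew\<close> (the sum of the coordinates). On a
  geometric line the midpoint vanishes in all \<open>R \<ge> 1\<close> moving coordinates. Hence both ends have the
  weight of the midpoint plus \<open>R\<close>, and their skews are those of the midpoint minus and plus some \<open>s\<close>
  with \<open>\<bar>s\<bar> \<le> R\<close> and \<open>s \<equiv> R (mod 2)\<close> (\<open>geometric_line_profile\<close>).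

  A full weight level is therefore a Moser set, and the levels near weight \<open>2n/3\<close> have size about
  \<open>sqrt (9 / (4 pi)) 3\<^sup>n / sqrt n\<close>. The factor 2 comes from adding thinned levels above a full level
  of weight \<open>w\<close>: half of the level \<open>w + 1\<close>, a quarter of the level \<open>w + 3\<close>, an eighth of the level
  \<open>w + 5\<close> and so on, where on the level \<open>w + 2u + 1\<close> exactly those points are kept whose skew,
  translated by a fixed \<open>t\<close>, has 2-adic valuation \<open>u + 1\<close>. If both ends of a line lie on this level,
  then \<open>2s\<close> is a difference of two numbers of valuation \<open>u + 1\<close>, so \<open>2\<^bsup>u+1\<^esup>\<close> divides \<open>s\<close>. This
  excludes a midpoint on level \<open>w\<close>, for which \<open>s\<close> would be odd; and for a midpoint on the level
  \<open>w + 2v + 1\<close> the bound \<open>\<bar>s\<bar> \<le> 2(u - v) < 2\<^bsup>u+1\<^esup>\<close> forces \<open>s = 0\<close>, so that the midpoint has the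
  translated skew of the ends, but should have another valuation (\<open>moser_set_ruler_set\<close>).

  The size is obtained by averaging: over a full period of admissible
  translations \<open>t\<close>, each point of the level \<open>w + 2u + 1\<close> is kept for exactly the fraction
  \<open>2\<^bsup>-(u+1)\<^esup>\<close> of them, so some \<open>t\<close> does at least as well as the average
  (\<open>exists_large_ruler_set\<close>). With \<open>M\<close> thinned levels the total is \<open>2 - 2\<^bsup>-M\<^esup>\<close> levels, since the
  sizes of levels at bounded distance from \<open>2n/3\<close> are asymptotically equal
  (\<open>level_size_asymptotic\<close>, from Stirling's formula). Finally \<open>M\<close> tends to infinity.
\<close>

section \<open>Weight and skew along a geometric line\<close>

definition weight :: "nat \<Rightarrow> (nat \<Rightarrow> int) \<Rightarrow> nat" where
  "weight n x = card {i\<in>{1..n}. x i \<noteq> 2}"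

definition skew :: "nat \<Rightarrow> (nat \<Rightarrow> int) \<Rightarrow> int" where
  "skew n x = (\<Sum>i\<in>{1..n}. x i - 2)"

lemma finite_cube3: "finite (cube3 n)"
  unfolding cube3_def by (intro finite_PiE) auto

lemma cube3_range: "x \<in> cube3 n \<Longrightarrow> i \<in> {1..n} \<Longrightarrow> x i = 1 \<or> x i = 2 \<or> x i = 3"
  by (auto simp: cube3_def PiE_def Pi_def)

lemma parity_sum_signs:
  fixes f :: "'a \<Rightarrow> int"
  assumes "finite A" "\<And>i. i \<in> A \<Longrightarrow> f i = 1 \<or> f i = -1"
  shows "even (sum f A) \<longleftrightarrow> even (card A)"
proof -
  have "even (sum f A) \<longleftrightarrow> even (card {i\<in>A. odd (f i)})"
    using assms(1) by (rule even_sum_iff)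
  also have "{i\<in>A. odd (f i)} = A" using assms(2) by force
  finally show ?thesis .
qed

text \<open>
  This parity coupling determines which translations of the skew can produce a positive 2-adic
  valuation on a given level.
\<close>
lemma even_skew_iff:
  assumes "x \<in> cube3 n"
  shows "even (skew n x) \<longleftrightarrow> even (weight n x)"
proof -
  have "skew n x = (\<Sum>i\<in>{i\<in>{1..n}. x i \<noteq> 2}. x i - 2)"
    unfolding skew_def by (intro sum.mono_neutral_right) auto
  moreover have "x i - 2 = 1 \<or> x i - 2 = -1" if "i \<in> {i\<in>{1..n}. x i \<noteq> 2}" for i
    using cube3_range[OF assms, of i] that by auto
  ultimately show ?thesis
    unfolding weight_def using parity_sum_signs[of "{i\<in>{1..n}. x i \<noteq> 2}" "\<lambda>i. x i - 2"] by auto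
qed

text \<open>
  A moving coordinate runs through 1, 2, 3 in one direction or the other, so it equals 2 at the
  midpoint. Here \<open>R\<close> counts the moving coordinates, and \<open>s\<close> is the sum of \<open>R\<close> steps, each 1 or -1.
\<close>
lemma geometric_line_profile:
  assumes "geometric_line n L"
  obtains x y z R s where "L = {x, y, z}" "R \<ge> 1" "\<bar>s\<bar> \<le> int R" "even s \<longleftrightarrow> even R"
    "weight n x = weight n y + R" "weight n z = weight n y + R"
    "skew n x = skew n y - s" "skew n z = skew n y + s"
proof -
  from assms obtain a r where r: "r \<in> lattice_points n" "r \<noteq> zero_point n"
    and L: "L = {line_point n a r 1, line_point n a r 2, line_point n a r 3}" "L \<subseteq> cube3 n"
    unfolding geometric_line_def by blast
  define A where "A = {i\<in>{1..n}. r i \<noteq> 0}"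
  define x y z where "x = line_point n a r 1" and "y = line_point n a r 2" and "z = line_point n a r 3"
  have Lxyz: "L = {x, y, z}" using L by (simp add: x_def y_def z_def)
  have coords: "x i = y i - r i" "z i = y i + r i" if "i \<in> {1..n}" for i
    using that by (simp_all add: x_def y_def z_def line_point_def)
  have in_cube: "x \<in> cube3 n" "y \<in> cube3 n" "z \<in> cube3 n" using L(2) by (auto simp: Lxyz)
  have moving: "y i = 2 \<and> (r i = 1 \<or> r i = -1)" if "i \<in> A" for i
  proof -
    have i: "i \<in> {1..n}" "r i \<noteq> 0" using that by (simp_all add: A_def)
    show ?thesis
      using cube3_range[OF in_cube(1) i(1)] cube3_range[OF in_cube(2) i(1)]
        cube3_range[OF in_cube(3) i(1)] i(2) unfolding coords[OF i(1)] by auto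
  qed
  have "A \<noteq> {}"
  proof
    assume "A = {}"
    hence "r i = zero_point n i" for i
      using r(1) by (cases "i \<in> {1..n}")
        (auto simp: A_def zero_point_def lattice_points_def PiE_def extensional_def)
    with r(2) show False by blast
  qed
  have switch: "x i \<noteq> 2 \<longleftrightarrow> y i \<noteq> 2 \<or> i \<in> A" "z i \<noteq> 2 \<longleftrightarrow> y i \<noteq> 2 \<or> i \<in> A" if "i \<in> {1..n}" for i
    using moving[of i] coords[OF that] that by (cases "i \<in> A"; force simp: A_def)+
  have split: "{i\<in>{1..n}. x i \<noteq> 2} = {i\<in>{1..n}. y i \<noteq> 2} \<union> A"
    "{i\<in>{1..n}. z i \<noteq> 2} = {i\<in>{1..n}. y i \<noteq> 2} \<union> A"
    using switch by (auto simp: A_def)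
  have "card ({i\<in>{1..n}. y i \<noteq> 2} \<union> A) = weight n y + card A"
    unfolding weight_def by (rule card_Un_disjoint) (use moving in \<open>auto simp: A_def\<close>)
  hence w: "weight n x = weight n y + card A" "weight n z = weight n y + card A"
    unfolding weight_def split by simp_all
  have s: "(\<Sum>i\<in>{1..n}. r i) = (\<Sum>i\<in>A. r i)"
    unfolding A_def by (intro sum.mono_neutral_right) auto
  have "\<bar>\<Sum>i\<in>A. r i\<bar> \<le> (\<Sum>i\<in>A. \<bar>r i\<bar>)" by (rule sum_abs)
  also have "\<dots> = (\<Sum>i\<in>A. 1)" by (intro sum.cong) (use moving in force)+
  finally have "\<bar>\<Sum>i\<in>{1..n}. r i\<bar> \<le> int (card A)" unfolding s by simp
  moreover have "even (\<Sum>i\<in>{1..n}. r i) \<longleftrightarrow> even (card A)"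
    unfolding s using moving by (intro parity_sum_signs) (auto simp: A_def)
  moreover have "card A \<ge> 1"
    using \<open>A \<noteq> {}\<close> by (simp add: Suc_le_eq card_gt_0_iff) (simp add: A_def)
  moreover have "skew n x = skew n y - (\<Sum>i\<in>{1..n}. r i)" "skew n z = skew n y + (\<Sum>i\<in>{1..n}. r i)"
    unfolding skew_def sum_subtractf[symmetric] sum.distrib[symmetric]
    by (rule sum.cong; use coords in force)+
  ultimately show ?thesis using that Lxyz w by blast
qed

section \<open>A Moser set of thinned weight levels\<close>

definition exact_pow2 :: "nat \<Rightarrow> int \<Rightarrow> bool" where
  "exact_pow2 k m \<longleftrightarrow> 2 ^ k dvd m \<and> \<not> 2 ^ Suc k dvd m"

text \<open>
  The translated skews admitted on successive thinned levels are marked like the graduations of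
  successive lengths on a binary ruler.
\<close>
definition ruler_set :: "nat \<Rightarrow> nat \<Rightarrow> nat \<Rightarrow> int \<Rightarrow> (nat \<Rightarrow> int) set" where
  "ruler_set n M w t = {x \<in> cube3 n. weight n x = w \<or>
     (\<exists>u<M. weight n x = w + 2 * u + 1 \<and> exact_pow2 (Suc u) (skew n x + t))}"

lemma exact_pow2_diff:
  assumes "exact_pow2 k a" "exact_pow2 k b"
  shows "2 ^ Suc k dvd a - b"
proof -
  obtain a' b' where ab: "a = 2 ^ k * a'" "b = 2 ^ k * b'"
    using assms by (auto simp: exact_pow2_def elim!: dvdE)
  with assms have "odd a'" "odd b'" by (auto simp: exact_pow2_def)
  hence "2 dvd a' - b'" by simp
  hence "2 ^ k * 2 dvd 2 ^ k * (a' - b')" by (rule mult_dvd_mono[OF dvd_refl])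
  thus ?thesis by (simp add: ab algebra_simps)
qed

lemma exact_pow2_unique: "exact_pow2 j m \<Longrightarrow> exact_pow2 k m \<Longrightarrow> j = k"
  unfolding exact_pow2_def by (metis Suc_leI dvd_trans le_imp_power_dvd linorder_neqE_nat)

text \<open>
  The higher a thinned level, the farther apart its admitted skews: a gap divisible by
  \<open>2\<^bsup>u+2\<^esup>\<close> outgrows the height difference \<open>2(u - v)\<close> that limits the skew along a line.
\<close>
lemma moser_set_ruler_set: "moser_set n (ruler_set n M w t)"
  unfolding moser_set_def
proof (intro conjI notI)
  show "ruler_set n M w t \<subseteq> cube3 n" by (auto simp: ruler_set_def)
next
  assume "\<exists>L. geometric_line n L \<and> L \<subseteq> ruler_set n M w t"
  then obtain L where line: "geometric_line n L" and sub: "L \<subseteq> ruler_set n M w t" by blast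
  from line obtain x y z R s where L: "L = {x, y, z}" and R: "R \<ge> 1"
    and s: "\<bar>s\<bar> \<le> int R" "even s \<longleftrightarrow> even R"
    and wt: "weight n x = weight n y + R" "weight n z = weight n y + R"
    and sk: "skew n x = skew n y - s" "skew n z = skew n y + s"
    by (rule geometric_line_profile)
  have mem: "x \<in> ruler_set n M w t" "y \<in> ruler_set n M w t" "z \<in> ruler_set n M w t"
    using sub L by auto
  have "weight n y \<ge> w" using mem(2) by (auto simp: ruler_set_def)
  hence "weight n x \<noteq> w" "weight n z \<noteq> w" using wt R by auto
  then obtain u where u: "weight n x = w + 2 * u + 1"
    and ends: "exact_pow2 (Suc u) (skew n x + t)" "exact_pow2 (Suc u) (skew n z + t)"
    using mem(1,3) wt by (auto simp: ruler_set_def)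
  have "2 ^ Suc (Suc u) dvd (skew n z + t) - (skew n x + t)"
    using ends by (intro exact_pow2_diff)
  also have "(skew n z + t) - (skew n x + t) = 2 * s" by (simp add: sk)
  finally have dvd_s: "2 ^ Suc u dvd s"
    by (metis dvd_mult_cancel_left power_Suc zero_neq_numeral)
  hence "even s" using dvd_trans[of 2 "2 ^ Suc u" s] by simp
  hence "even R" using s by simp
  hence "weight n y \<noteq> w" using u wt by auto
  then obtain v where v: "weight n y = w + 2 * v + 1" "exact_pow2 (Suc v) (skew n y + t)"
    using mem(2) by (auto simp: ruler_set_def)
  have pow: "2 * u < 2 ^ Suc u" by simp
  have "R = 2 * u - 2 * v" "v < u" using u v wt R by auto
  hence "\<bar>s\<bar> < int (2 * u) + 1" using s(1) by simp
  also have "int (2 * u) + 1 \<le> 2 ^ Suc u"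
    using pow by (metis of_nat_less_iff of_nat_numeral of_nat_power zless_imp_add1_zle)
  finally have "s = 0"
    using dvd_s zdvd_not_zless[of "\<bar>s\<bar>" "2 ^ Suc u"] by force
  hence "exact_pow2 (Suc u) (skew n y + t)" using ends sk by simp
  with v(2) \<open>v < u\<close> show False using exact_pow2_unique by blast
qed

section \<open>Averaging over translations of the skew\<close>

lemma card_level: "card {x \<in> cube3 n. weight n x = w} = (n choose w) * 2 ^ w"
proof -
  define F where "F A = (\<Pi>\<^sub>E i\<in>{1..n}. if i \<in> A then {1, 3} else {2 :: int})" for A
  define D where "D x = {i\<in>{1..n}. x i \<noteq> 2}" for x :: "nat \<Rightarrow> int"
  have D: "D x \<subseteq> {1..n}" "weight n x = card (D x)" for x
    by (auto simp: D_def weight_def)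
  have mem_F: "x \<in> F A \<longleftrightarrow> x \<in> cube3 n \<and> D x = A" if "A \<subseteq> {1..n}" for A x
  proof -
    have "v \<in> (if i \<in> A then {1, 3} else {2}) \<longleftrightarrow> v \<in> {1, 2, 3} \<and> (v \<noteq> 2 \<longleftrightarrow> i \<in> A)" for v :: int and i
      by auto
    hence "x \<in> F A \<longleftrightarrow> x \<in> cube3 n \<and> (\<forall>i\<in>{1..n}. x i \<noteq> 2 \<longleftrightarrow> i \<in> A)"
      unfolding F_def cube3_def PiE_iff by blast
    also have "(\<forall>i\<in>{1..n}. x i \<noteq> 2 \<longleftrightarrow> i \<in> A) \<longleftrightarrow> D x = A"
      using that unfolding D_def by blast
    finally show ?thesis .
  qed
  have "{x \<in> cube3 n. weight n x = w} = (\<Union>A\<in>{A. A \<subseteq> {1..n} \<and> card A = w}. F A)"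
  proof (intro equalityI subsetI)
    fix x assume "x \<in> {x \<in> cube3 n. weight n x = w}"
    hence "x \<in> F (D x)" "card (D x) = w" using mem_F[OF D(1)] D(2) by simp_all
    thus "x \<in> (\<Union>A\<in>{A. A \<subseteq> {1..n} \<and> card A = w}. F A)" using D(1) by blast
  next
    fix x assume "x \<in> (\<Union>A\<in>{A. A \<subseteq> {1..n} \<and> card A = w}. F A)"
    then obtain A where A: "A \<subseteq> {1..n}" "card A = w" "x \<in> F A" by blast
    hence "x \<in> cube3 n" "D x = A" using mem_F[OF A(1)] by blast+
    thus "x \<in> {x \<in> cube3 n. weight n x = w}" using A(2) D(2) by simp
  qed
  also have "card \<dots> = (\<Sum>A\<in>{A. A \<subseteq> {1..n} \<and> card A = w}. card (F A))"
  proof (intro card_UN_disjoint ballI impI)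
    show "finite {A. A \<subseteq> {1..n} \<and> card A = w}" by simp
    show "finite (F A)" for A unfolding F_def by (intro finite_PiE) auto
    show "F A \<inter> F B = {}" if "A \<in> {A. A \<subseteq> {1..n} \<and> card A = w}"
      "B \<in> {A. A \<subseteq> {1..n} \<and> card A = w}" "A \<noteq> B" for A B
    proof -
      have "A \<subseteq> {1..n}" "B \<subseteq> {1..n}" using that by simp_all
      hence "x \<notin> F A \<or> x \<notin> F B" for x
        using mem_F[of A x] mem_F[of B x] \<open>A \<noteq> B\<close> by metis
      thus ?thesis by blast
    qed
  qed
  also have "\<dots> = (\<Sum>A\<in>{A. A \<subseteq> {1..n} \<and> card A = w}. 2 ^ w)"
  proof (rule sum.cong)
    fix A assume A: "A \<in> {A. A \<subseteq> {1..n} \<and> card A = w}"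
    have "card (F A) = (\<Prod>i\<in>{1..n}. if i \<in> A then 2 else 1)"
      unfolding F_def by (subst card_PiE) (auto intro!: prod.cong)
    also have "\<dots> = (\<Prod>i\<in>A. 2)"
      using A by (intro prod.mono_neutral_cong_right) auto
    finally show "card (F A) = 2 ^ w" using A by simp
  qed simp
  also have "\<dots> = (n choose w) * 2 ^ w"
    by (simp add: n_subsets)
  finally show ?thesis .
qed

lemma card_multiples_in_period:
  fixes e :: int
  assumes "j \<le> M"
  shows "card {k \<in> {0..<2 ^ M}. 2 ^ j dvd e + int k} = 2 ^ (M - j)"
proof -
  define c where "c = nat ((- e) mod 2 ^ j)"
  have c: "int c = (- e) mod 2 ^ j" "c < 2 ^ j"
    unfolding c_def by (simp_all add: nat_less_iff)
  have M: "(2::nat) ^ M = 2 ^ j * 2 ^ (M - j)" using assms by (simp add: power_add[symmetric])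
  have iff: "2 ^ j dvd e + int k \<longleftrightarrow> k mod 2 ^ j = c" for k
  proof -
    have "2 ^ j dvd e + int k \<longleftrightarrow> int k mod 2 ^ j = (- e) mod 2 ^ j"
      by (simp add: mod_eq_dvd_iff add.commute)
    also have "\<dots> \<longleftrightarrow> int (k mod 2 ^ j) = int c" by (simp add: c zmod_int)
    finally show ?thesis by simp
  qed
  have "bij_betw (\<lambda>i. c + 2 ^ j * i) {0..<2 ^ (M - j)} {k \<in> {0..<2 ^ M}. 2 ^ j dvd e + int k}"
  proof (rule bij_betw_byWitness[where f' = "\<lambda>k. k div 2 ^ j"])
    show "(\<lambda>i. c + 2 ^ j * i) ` {0..<2 ^ (M - j)} \<subseteq> {k \<in> {0..<2 ^ M}. 2 ^ j dvd e + int k}"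
    proof safe
      fix i :: nat assume i: "i \<in> {0..<2 ^ (M - j)}"
      have "c + 2 ^ j * i < 2 ^ j * Suc i" using c(2) by simp
      also have "\<dots> \<le> 2 ^ M" unfolding M using i by (intro mult_le_mono2) auto
      finally show "c + 2 ^ j * i \<in> {0..<2 ^ M}" by simp
      show "2 ^ j dvd e + int (c + 2 ^ j * i)" unfolding iff using c(2) by simp
    qed
    show "(\<lambda>k. k div 2 ^ j) ` {k \<in> {0..<2 ^ M}. 2 ^ j dvd e + int k} \<subseteq> {0..<2 ^ (M - j)}"
      unfolding M by (auto simp: less_mult_imp_div_less mult.commute)
    show "\<forall>i\<in>{0..<2 ^ (M - j)}. (c + 2 ^ j * i) div 2 ^ j = i" using c(2) by simp
    show "\<forall>k\<in>{k \<in> {0..<2 ^ M}. 2 ^ j dvd e + int k}. c + 2 ^ j * (k div 2 ^ j) = k"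
    proof safe
      fix k :: nat assume "2 ^ j dvd e + int k"
      hence "k mod 2 ^ j = c" using iff by blast
      thus "c + 2 ^ j * (k div 2 ^ j) = k" using mod_mult_div_eq[of k "2 ^ j"] by simp
    qed
  qed
  from bij_betw_same_card[OF this] show ?thesis by simp
qed

lemma card_exact_pow2_in_period:
  fixes e :: int
  assumes "u < M"
  shows "card {k \<in> {0..<2 ^ M}. exact_pow2 u (e + int k)} = 2 ^ (M - Suc u)"
proof -
  have sub: "{k \<in> {0..<2 ^ M}. 2 ^ Suc u dvd e + int k} \<subseteq> {k \<in> {0..<2 ^ M}. 2 ^ u dvd e + int k}"
    using dvd_trans[OF le_imp_power_dvd[of u "Suc u" "2 :: int"]] by auto
  have "{k \<in> {0..<2 ^ M}. exact_pow2 u (e + int k)} =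
      {k \<in> {0..<2 ^ M}. 2 ^ u dvd e + int k} - {k \<in> {0..<2 ^ M}. 2 ^ Suc u dvd e + int k}"
    by (auto simp: exact_pow2_def)
  also have "card \<dots> = 2 ^ (M - u) - 2 ^ (M - Suc u)"
    using assms by (subst card_Diff_subset[OF _ sub])
      (simp_all only: card_multiples_in_period Suc_leI less_imp_le, simp)
  also have "M - u = Suc (M - Suc u)" using assms by simp
  finally show ?thesis by simp
qed

lemma exact_pow2_double: "exact_pow2 (Suc u) (2 * m) \<longleftrightarrow> exact_pow2 u m"
proof -
  have "2 ^ Suc k dvd 2 * m \<longleftrightarrow> 2 ^ k dvd m" for k by simp
  thus ?thesis by (simp only: exact_pow2_def)
qed

definition level_size :: "nat \<Rightarrow> nat \<Rightarrow> real" where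
  "level_size n w = real (n choose w) * 2 ^ w"

text \<open>
  On the level \<open>w + 2u + 1\<close> the number \<open>skew + w + 1\<close> is even. So only translations congruent to
  \<open>w + 1\<close> modulo 2 are averaged; over all integers the density would be only half as large.
\<close>
lemma exists_large_ruler_set:
  "\<exists>t. real (card (ruler_set n M w t)) \<ge>
     level_size n w + (\<Sum>u<M. level_size n (w + 2 * u + 1) / 2 ^ Suc u)"
proof -
  define V where "V v = {x \<in> cube3 n. weight n x = v}" for v
  define T where "T k = int w + 1 + 2 * int k" for k
  define P where "P u k = {x \<in> V (w + 2 * u + 1). exact_pow2 (Suc u) (skew n x + T k)}" for u k
  have fin: "finite (V v)" "finite (P u k)" for v u k
    using finite_cube3 by (auto simp: V_def P_def)
  have hits: "card {k \<in> {0..<2 ^ M}. exact_pow2 (Suc u) (skew n x + T k)} = 2 ^ (M - Suc u)"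
    if x: "x \<in> V (w + 2 * u + 1)" and "u < M" for x u
  proof -
    have "even (skew n x + int w + 1)"
      using x even_skew_iff[of x n] by (auto simp: V_def)
    then obtain e where e: "skew n x + int w + 1 = 2 * e" by (elim evenE)
    hence "skew n x + T k = 2 * (e + int k)" for k by (simp add: T_def)
    thus ?thesis using card_exact_pow2_in_period[OF \<open>u < M\<close>, of e]
      by (simp only: exact_pow2_double)
  qed
  have split: "card (ruler_set n M w (T k)) = card (V w) + (\<Sum>u<M. card (P u k))" for k
  proof -
    have "ruler_set n M w (T k) = V w \<union> (\<Union>u<M. P u k)"
      by (auto simp: ruler_set_def V_def P_def)
    also have "card \<dots> = card (V w) + card (\<Union>u<M. P u k)"
      using fin by (intro card_Un_disjoint) (auto simp: V_def P_def)
    also have "card (\<Union>u<M. P u k) = (\<Sum>u<M. card (P u k))"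
      using fin by (intro card_UN_disjoint) (auto simp: V_def P_def)
    finally show ?thesis .
  qed
  \<comment> \<open>Double counting: sum over the points the number of translations that keep them.\<close>
  have total_P: "(\<Sum>k\<in>{0..<2 ^ M}. card (P u k)) = card (V (w + 2 * u + 1)) * 2 ^ (M - Suc u)"
    if "u < M" for u
  proof -
    have "(\<Sum>k\<in>{0..<2 ^ M}. card (P u k)) =
        (\<Sum>x\<in>V (w + 2 * u + 1). card {k \<in> {0..<2 ^ M}. exact_pow2 (Suc u) (skew n x + T k)})"
      unfolding P_def using fin by (intro sum_multicount_gen) auto
    also have "\<dots> = (\<Sum>x\<in>V (w + 2 * u + 1). 2 ^ (M - Suc u))"
      using hits that by (intro sum.cong) auto
    finally show ?thesis by simp
  qed
  define B where "B = real (card (V w)) + (\<Sum>u<M. real (card (V (w + 2 * u + 1))) / 2 ^ Suc u)"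
  have "(\<Sum>k\<in>{0..<2 ^ M}. card (ruler_set n M w (T k)))
      = 2 ^ M * card (V w) + (\<Sum>u<M. \<Sum>k\<in>{0..<2 ^ M}. card (P u k))"
    unfolding split sum.distrib by (subst sum.swap) simp
  also have "\<dots> = 2 ^ M * card (V w) + (\<Sum>u<M. card (V (w + 2 * u + 1)) * 2 ^ (M - Suc u))"
    using total_P by simp
  also have "real \<dots> = 2 ^ M * real (card (V w)) +
      (\<Sum>u<M. real (card (V (w + 2 * u + 1)) * 2 ^ (M - Suc u)))"
    by (simp only: of_nat_add of_nat_mult of_nat_sum of_nat_power of_nat_numeral)
  also have "(\<Sum>u<M. real (card (V (w + 2 * u + 1)) * 2 ^ (M - Suc u)))
      = (\<Sum>u<M. 2 ^ M * (real (card (V (w + 2 * u + 1))) / 2 ^ Suc u))"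
  proof (rule sum.cong)
    fix u assume "u \<in> {..<M}"
    hence "(2::real) ^ (M - Suc u) = 2 ^ M / 2 ^ Suc u" by (intro power_diff) auto
    thus "real (card (V (w + 2 * u + 1)) * 2 ^ (M - Suc u))
        = 2 ^ M * (real (card (V (w + 2 * u + 1))) / 2 ^ Suc u)"
      unfolding of_nat_mult of_nat_power of_nat_numeral by simp
  qed simp
  also have "2 ^ M * real (card (V w)) + \<dots> = 2 ^ M * B"
    by (simp only: B_def distrib_left sum_distrib_left)
  finally have avg: "(\<Sum>k\<in>{0..<2 ^ M}. real (card (ruler_set n M w (T k)))) = 2 ^ M * B" by simp
  have "\<exists>k\<in>{0..<2 ^ M}. real (card (ruler_set n M w (T k))) \<ge> B"
  proof (rule ccontr)
    assume "\<not> ?thesis"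
    hence "(\<Sum>k\<in>{0..<2 ^ M::nat}. real (card (ruler_set n M w (T k)))) < (\<Sum>k\<in>{0..<2 ^ M::nat}. B)"
      by (intro sum_strict_mono) (auto simp: not_le)
    with avg show False by simp
  qed
  moreover have level: "real (card (V v)) = level_size n v" for v
    by (simp add: V_def card_level level_size_def)
  ultimately show ?thesis unfolding B_def level by blast
qed

lemma moser_number_ge:
  assumes "moser_set n S"
  shows "card S \<le> moser_number n"
proof -
  have "finite {S. moser_set n S}"
    using finite_cube3[of n] by (rule_tac finite_subset[of _ "Pow (cube3 n)"]) (auto simp: moser_set_def)
  thus ?thesis using assms unfolding moser_number_def by (intro Max_ge) auto
qed

lemma moser_number_ge_levels:
  "real (moser_number n) \<ge> level_size n w + (\<Sum>u<M. level_size n (w + 2 * u + 1) / 2 ^ Suc u)"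
proof -
  obtain t where "level_size n w + (\<Sum>u<M. level_size n (w + 2 * u + 1) / 2 ^ Suc u)
      \<le> real (card (ruler_set n M w t))"
    using exists_large_ruler_set by blast
  also have "\<dots> \<le> real (moser_number n)"
    using moser_number_ge[OF moser_set_ruler_set] by simp
  finally show ?thesis .
qed


section \<open>Stirling's formula\<close>

definition stirling_quotient :: "nat \<Rightarrow> real" where
  "stirling_quotient n = fact n / (sqrt (real n) * (real n / exp 1) ^ n)"

text \<open>
  The logarithms decrease, and the decrements are bounded by the telescoping differences of
  \<open>1/(4n)\<close>; both bounds are classical rational approximations of \<open>ln (n + 1) - ln n\<close>.
\<close>
lemma stirling_quotient_converges: "\<exists>C>0. stirling_quotient \<longlonglongrightarrow> C"
proof -
  define s where "s n = ln (stirling_quotient (Suc n))" for n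
  have pos: "stirling_quotient (Suc n) > 0" for n
    by (simp add: stirling_quotient_def)
  have s_eq: "s n = ln (fact (Suc n)) - (real (Suc n) + 1/2) * ln (real (Suc n)) + real (Suc n)" for n
  proof -
    define x where "x = real (Suc n)"
    have x: "x > 0" by (simp add: x_def)
    have "s n = ln (fact (Suc n) / (sqrt x * (x / exp 1) ^ Suc n))"
      by (simp only: s_def stirling_quotient_def x_def)
    also have "\<dots> = ln (fact (Suc n)) - (ln (sqrt x) + x * ln (x / exp 1))"
      using x by (simp only: ln_divide_pos ln_mult_pos ln_realpow fact_gt_zero mult_pos_pos
        real_sqrt_gt_zero zero_less_power divide_pos_pos exp_gt_zero) (simp add: x_def)
    also have "\<dots> = ln (fact (Suc n)) - (x + 1/2) * ln x + x"
      using x by (simp add: ln_sqrt ln_divide_pos algebra_simps del: fact_Suc)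
    finally show ?thesis by (simp only: x_def)
  qed
  have diff: "s n - s (Suc n) = (real (Suc n) + 1/2) * (ln (real (Suc n) + 1) - ln (real (Suc n))) - 1" for n
  proof -
    have "ln (fact (Suc (Suc n)) :: real) = ln (real (Suc n) + 1) + ln (fact (Suc n))"
      by (subst fact_Suc, subst ln_mult) (auto simp: add_ac)
    thus ?thesis
      unfolding s_eq by (simp add: algebra_simps del: fact_Suc)
  qed
  have "decseq s"
  proof (rule decseq_SucI)
    fix n
    define x where "x = real (Suc n)"
    have x: "x > 0" by (simp add: x_def)
    have "(x + 1/2) * (2 * (x + 1 - x) / (x + (x + 1))) \<le> (x + 1/2) * (ln (x + 1) - ln x)"
      using x by (intro mult_left_mono ln_inverse_approx_ge) auto
    also have "(x + 1/2) * (2 * (x + 1 - x) / (x + (x + 1))) = 1"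
      using x by (simp add: field_simps)
    finally show "s (Suc n) \<le> s n" using diff[of n] by (simp add: x_def)
  qed
  have step: "s n - s (Suc n) \<le> 1 / (4 * real (Suc n)) - 1 / (4 * real (Suc (Suc n)))" for n
  proof -
    define x where "x = real (Suc n)"
    have x: "x > 0" by (simp add: x_def)
    have "(x + 1/2) * (ln (x + 1) - ln x) \<le> (x + 1/2) * (1 * (inverse x + inverse (x + 1)) / 2)"
      using x by (intro mult_left_mono ln_inverse_approx_le) auto
    also have "\<dots> = 1 + (1 / (4 * x) - 1 / (4 * (x + 1)))"
      using x by (simp add: divide_simps) (simp add: algebra_simps power2_eq_square)
    finally show ?thesis using diff[of n] by (simp add: x_def add_ac)
  qed
  have lower: "s 0 - 1/4 \<le> s n - 1 / (4 * real (Suc n))" for n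
  proof (induction n)
    case (Suc n)
    then show ?case using step[of n] by linarith
  qed simp
  have "s 0 - 1/4 \<le> s n" for n
    using lower[of n] by (smt (verit) divide_nonneg_nonneg of_nat_0_le_iff)
  then obtain l where l: "s \<longlonglongrightarrow> l"
    using decseq_convergent[OF \<open>decseq s\<close>] by blast
  have "(\<lambda>n. exp (s n)) \<longlonglongrightarrow> exp l"
    using l by (intro tendsto_intros)
  hence "(\<lambda>n. stirling_quotient (Suc n)) \<longlonglongrightarrow> exp l"
    unfolding s_def using pos by simp
  hence "stirling_quotient \<longlonglongrightarrow> exp l" by (simp only: filterlim_sequentially_Suc)
  thus ?thesis by (intro exI[of _ "exp l"]) auto
qed

lemma stirling_quotient_pos: "n > 0 \<Longrightarrow> stirling_quotient n > 0"
  by (simp add: stirling_quotient_def)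

lemma fact_eq_stirling_quotient:
  "n > 0 \<Longrightarrow> fact n = stirling_quotient n * (sqrt (real n) * (real n / exp 1) ^ n)"
  by (simp add: stirling_quotient_def)

lemma power_scaled_base: "(c * x) ^ (k * m) = (c ^ k) ^ m * (x ^ m) ^ k" for c x :: real
  by (simp add: power_mult_distrib power_mult[symmetric] mult.commute)

text \<open>
  Up to sign, \<open>(2n choose n) / 4\<^sup>n\<close> is the generalized binomial coefficient of -1/2, whose decay is
  governed by \<open>Gamma (1/2) = sqrt pi\<close>. This is what identifies the constant in Stirling's formula.
\<close>
lemma central_binomial_limit:
  "(\<lambda>n. sqrt (real n) * real ((2 * n) choose n) / 4 ^ n) \<longlonglongrightarrow> 1 / sqrt pi"
proof -
  have "(\<lambda>n. ((-1/2 :: real) gchoose n) / ((-1)^n / exp ((-1/2 + 1) * ln (real n)))) \<longlonglongrightarrow> inverse (Gamma (- (-1/2)))"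
    using gbinomial_asymptotic[of "-1/2 :: real"] by simp
  moreover have "inverse (Gamma (- (-1/2) :: real)) = 1 / sqrt pi"
    by (simp add: Gamma_one_half_real inverse_eq_divide)
  moreover have "((-1/2 :: real) gchoose n) / ((-1)^n / exp ((-1/2 + 1) * ln (real n)))
      = sqrt (real n) * real ((2 * n) choose n) / 4 ^ n" if "n > 0" for n
  proof -
    have "exp ((-1/2 + 1) * ln (real n)) = sqrt (real n)"
      using that by (simp add: powr_half_sqrt[symmetric] powr_def)
    moreover have "(-1/2 :: real) gchoose n = (-1) ^ n * pochhammer (1/2) n / fact n"
      by (simp add: gbinomial_pochhammer)
    moreover have "real ((2 * n) choose n) = 4 ^ n * pochhammer (1/2) n / fact n"
      by (subst binomial_fact)  (auto simp: fact_double power_mult)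
    ultimately show ?thesis
      by (simp only:) (simp add: field_simps)
  qed
  ultimately show ?thesis
    by (auto elim!: Lim_transform_eventually intro!: eventually_mono[OF eventually_gt_at_top[of 0]])
qed

lemma stirling_quotient_tendsto: "stirling_quotient \<longlonglongrightarrow> sqrt (2 * pi)"
proof -
  obtain C where C: "C > 0" "stirling_quotient \<longlonglongrightarrow> C"
    using stirling_quotient_converges by blast
  have sub: "(\<lambda>n. stirling_quotient (2 * n)) \<longlonglongrightarrow> C"
    using C(2) by (rule filterlim_compose) real_asymp
  have "(\<lambda>n. sqrt 2 * stirling_quotient (2 * n) / (stirling_quotient n)\<^sup>2) \<longlonglongrightarrow> sqrt 2 * C / C\<^sup>2"
    using C sub by (intro tendsto_intros) auto
  moreover have "sqrt 2 * stirling_quotient (2 * n) / (stirling_quotient n)\<^sup>2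
      = sqrt (real n) * real ((2 * n) choose n) / 4 ^ n" if n: "n > 0" for n
  proof -
    have "real ((2 * n) choose n) = fact (2 * n) / (fact n * fact n)"
      by (subst binomial_fact) auto
    also have "\<dots> = stirling_quotient (2 * n) * (sqrt (real (2 * n)) * (real (2 * n) / exp 1) ^ (2 * n))
        / (stirling_quotient n * (sqrt (real n) * (real n / exp 1) ^ n))\<^sup>2"
      using n by (subst (1 2 3) fact_eq_stirling_quotient) (simp_all add: power2_eq_square)
    also have "\<dots> = sqrt 2 * stirling_quotient (2 * n) / (stirling_quotient n)\<^sup>2 * (4 ^ n / sqrt (real n))"
      using n stirling_quotient_pos[OF n]
      using power_scaled_base[of 2 "real n / exp 1" 2 n]
      by (simp add: real_sqrt_mult field_simps power2_eq_square)
    finally show ?thesis using n by (simp add: field_simps)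
  qed
  ultimately have "(\<lambda>n. sqrt (real n) * real ((2 * n) choose n) / 4 ^ n) \<longlonglongrightarrow> sqrt 2 * C / C\<^sup>2"
    by (auto elim!: Lim_transform_eventually intro!: eventually_mono[OF eventually_gt_at_top[of 0]])
  hence "sqrt 2 * C / C\<^sup>2 = 1 / sqrt pi"
    using central_binomial_limit LIMSEQ_unique by blast
  hence "C = sqrt (2 * pi)"
    using C(1) by (simp add: field_simps power2_eq_square real_sqrt_mult)
  thus ?thesis using C by simp
qed

section \<open>Asymptotic size of a level near weight \<open>2n/3\<close>\<close>

lemma level_size_base:
  "(\<lambda>m. level_size (3 * m) (2 * m) * sqrt (real m) / 27 ^ m) \<longlonglongrightarrow> sqrt 3 / (2 * sqrt pi)"
proof -
  have sub: "(\<lambda>n. stirling_quotient (k * n)) \<longlonglongrightarrow> sqrt (2 * pi)" if "k > 0" for k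
    using that by (intro filterlim_compose[OF stirling_quotient_tendsto] mult_nat_left_at_top)
  have "(\<lambda>m. sqrt 3 / sqrt 2 * (stirling_quotient (3 * m) / (stirling_quotient (2 * m) * stirling_quotient m)))
     \<longlonglongrightarrow> sqrt 3 / sqrt 2 * (sqrt (2 * pi) / (sqrt (2 * pi) * sqrt (2 * pi)))"
    by (intro tendsto_intros sub stirling_quotient_tendsto) auto
  also have "sqrt 3 / sqrt 2 * (sqrt (2 * pi) / (sqrt (2 * pi) * sqrt (2 * pi))) = sqrt 3 / (2 * sqrt pi)"
    by (simp add: real_sqrt_mult field_simps)
  finally have "(\<lambda>m. sqrt 3 / sqrt 2 * (stirling_quotient (3 * m) / (stirling_quotient (2 * m) * stirling_quotient m)))
     \<longlonglongrightarrow> sqrt 3 / (2 * sqrt pi)" .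
  moreover have "sqrt 3 / sqrt 2 * (stirling_quotient (3 * m) / (stirling_quotient (2 * m) * stirling_quotient m))
      = level_size (3 * m) (2 * m) * sqrt (real m) / 27 ^ m" if m: "m > 0" for m
  proof -
    have "real ((3 * m) choose (2 * m)) = fact (3 * m) / (fact (2 * m) * fact m)"
      by (subst binomial_fact) auto
    also have "\<dots> = stirling_quotient (3 * m) * (sqrt (real (3 * m)) * (real (3 * m) / exp 1) ^ (3 * m))
        / (stirling_quotient (2 * m) * (sqrt (real (2 * m)) * (real (2 * m) / exp 1) ^ (2 * m))
           * (stirling_quotient m * (sqrt (real m) * (real m / exp 1) ^ m)))"
      using m by (subst (1 2 3) fact_eq_stirling_quotient) simp_all
    also have "\<dots> = sqrt 3 / sqrt 2 * (stirling_quotient (3 * m) / (stirling_quotient (2 * m) * stirling_quotient m))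
        * (27 ^ m / (4 ^ m * sqrt (real m)))"
    proof -
      define X where "X = (real m / exp 1) ^ m"
      have X: "X > 0" using m by (simp add: X_def)
      have "(real (3 * m) / exp 1) ^ (3 * m) = 27 ^ m * X ^ 3"
        unfolding X_def using power_scaled_base[of 3 "real m / exp 1" 3 m] by simp
      moreover have "(real (2 * m) / exp 1) ^ (2 * m) = 4 ^ m * X ^ 2"
        unfolding X_def using power_scaled_base[of 2 "real m / exp 1" 2 m] by simp
      ultimately show ?thesis
        unfolding X_def[symmetric]
        using m X stirling_quotient_pos[of m] stirling_quotient_pos[of "2 * m"]
        by (simp only:) (simp add: real_sqrt_mult field_simps power2_eq_square power3_eq_cube)
    qed
    finally have "real ((3 * m) choose (2 * m)) = \<dots>" .
    moreover have "level_size (3 * m) (2 * m) = real ((3 * m) choose (2 * m)) * 4 ^ m"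
      by (simp add: level_size_def power_mult)
    ultimately show ?thesis using m
      by (simp only:) (simp add: field_simps)
  qed
  ultimately show ?thesis
    by (auto elim!: Lim_transform_eventually intro!: eventually_mono[OF eventually_gt_at_top[of 0]])
qed

lemma level_size_Suc_dim:
  assumes "w \<le> n"
  shows "level_size (Suc n) w = level_size n w * (real (n + 1) / real (n + 1 - w))"
proof -
  have "(Suc n - w) * (Suc n choose w) = Suc n * (n choose w)"
    using binomial_absorb_comp[of "Suc n" w] by simp
  hence "real (Suc n - w) * real (Suc n choose w) = real (Suc n) * real (n choose w)"
    by (metis of_nat_mult)
  hence "real (Suc n choose w) = real (n choose w) * (real (n + 1) / real (n + 1 - w))"
    using assms by (simp add: field_simps)
  thus ?thesis by (simp add: level_size_def)
qed

lemma level_size_Suc_weight: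
  assumes "w \<le> n"
  shows "level_size n (Suc w) = level_size n w * (2 * real (n - w) / real (w + 1))"
proof -
  have "Suc w * (n choose Suc w) = (n - w) * (n choose w)"
    using binomial_absorption[of w n] binomial_absorb_comp[of n w] by simp
  hence "real (Suc w) * real (n choose Suc w) = real (n - w) * real (n choose w)"
    by (metis of_nat_mult)
  hence "real (n choose Suc w) = real (n choose w) * (real (n - w) / real (w + 1))"
    by (simp add: field_simps)
  thus ?thesis by (simp add: level_size_def)
qed

text \<open>
  Raising the dimension by one near \<open>n = 3m\<close>, \<open>w = 2m\<close> multiplies a level size by a factor tending
  to 3, and raising the weight by one multiplies it by a factor tending to 1. So the limit in the
  diagonal case carries over to bounded offsets \<open>r\<close> and \<open>j\<close>.
\<close>
lemma level_size_asymptotic_residue: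
  "(\<lambda>m. level_size (3 * m + r) (2 * m + j) * sqrt (real m) / 3 ^ (3 * m + r))
     \<longlonglongrightarrow> sqrt 3 / (2 * sqrt pi)"
proof (induction j)
  case 0
  show ?case
  proof (induction r)
    case 0
    show ?case using level_size_base by (simp add: power_mult)
  next
    case (Suc r)
    have "(\<lambda>m. level_size (3 * m + r) (2 * m + 0) * sqrt (real m) / 3 ^ (3 * m + r) *
        (real (3 * m + r + 1) / real (m + r + 1) / 3)) \<longlonglongrightarrow> sqrt 3 / (2 * sqrt pi) * 1"
      by (intro tendsto_mult Suc.IH) real_asymp
    thus ?case by (simp add: level_size_Suc_dim field_simps)
  qed
next
  case (Suc j)
  have "(\<lambda>m. level_size (3 * m + r) (2 * m + j) * sqrt (real m) / 3 ^ (3 * m + r) *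
      (2 * (real m + real r - real j) / real (2 * m + j + 1))) \<longlonglongrightarrow> sqrt 3 / (2 * sqrt pi) * 1"
    by (intro tendsto_mult Suc.IH) real_asymp
  moreover have "level_size (3 * m + r) (2 * m + j) * sqrt (real m) / 3 ^ (3 * m + r) *
      (2 * (real m + real r - real j) / real (2 * m + j + 1))
     = level_size (3 * m + r) (2 * m + Suc j) * sqrt (real m) / 3 ^ (3 * m + r)" if "m \<ge> j" for m
  proof -
    have "real (3 * m + r - (2 * m + j)) = real m + real r - real j" using that by simp
    thus ?thesis using that level_size_Suc_weight[of "2 * m + j" "3 * m + r"] by (simp add: mult_ac)
  qed
  ultimately show ?case
    by (auto elim!: Lim_transform_eventually intro!: eventually_mono[OF eventually_ge_at_top[of j]])
qed

lemma tendsto_residue_classes: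
  fixes f :: "nat \<Rightarrow> 'a :: topological_space"
  assumes "q > 0" "\<And>r. r < q \<Longrightarrow> (\<lambda>m. f (q * m + r)) \<longlonglongrightarrow> L"
  shows "f \<longlonglongrightarrow> L"
proof (rule topological_tendstoI)
  fix S assume "open S" "L \<in> S"
  hence "\<forall>r\<in>{..<q}. eventually (\<lambda>m. f (q * m + r) \<in> S) sequentially"
    using assms(2) topological_tendstoD by blast
  hence "eventually (\<lambda>m. \<forall>r\<in>{..<q}. f (q * m + r) \<in> S) sequentially"
    by (intro eventually_ball_finite) auto
  moreover have "filterlim (\<lambda>n. n div q) sequentially sequentially"
    using \<open>q > 0\<close> by (intro filterlim_at_top_div_const_nat)
  ultimately have "eventually (\<lambda>n. \<forall>r\<in>{..<q}. f (q * (n div q) + r) \<in> S) sequentially"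
    by (rule eventually_compose_filterlim)
  thus "eventually (\<lambda>n. f n \<in> S) sequentially"
  proof eventually_elim
    case (elim n)
    hence "f (q * (n div q) + n mod q) \<in> S" using \<open>q > 0\<close> mod_less_divisor by blast
    thus ?case by (simp only: mult_div_mod_eq)
  qed
qed

lemma level_size_asymptotic:
  "(\<lambda>n. level_size n (2 * (n div 3) + j) * sqrt (real n) / 3 ^ n) \<longlonglongrightarrow> sqrt (9 / (4 * pi))"
proof (rule tendsto_residue_classes[of 3])
  fix r :: nat assume r: "r < 3"
  have "(\<lambda>m. level_size (3 * m + r) (2 * m + j) * sqrt (real m) / 3 ^ (3 * m + r) *
        sqrt (real (3 * m + r) / real m)) \<longlonglongrightarrow> sqrt 3 / (2 * sqrt pi) * sqrt 3"
    by (intro tendsto_mult level_size_asymptotic_residue tendsto_real_sqrt) real_asymp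
  also have "sqrt 3 / (2 * sqrt pi) * sqrt 3 = sqrt (9 / (4 * pi))"
    by (simp add: real_sqrt_divide real_sqrt_mult)
  finally show "(\<lambda>m. level_size (3 * m + r) (2 * ((3 * m + r) div 3) + j) * sqrt (real (3 * m + r))
        / 3 ^ (3 * m + r)) \<longlonglongrightarrow> sqrt (9 / (4 * pi))"
  proof (rule Lim_transform_eventually)
    show "eventually (\<lambda>m. level_size (3 * m + r) (2 * m + j) * sqrt (real m) / 3 ^ (3 * m + r) *
        sqrt (real (3 * m + r) / real m) = level_size (3 * m + r) (2 * ((3 * m + r) div 3) + j) 
         * sqrt (real (3 * m + r)) / 3 ^ (3 * m + r)) sequentially"
      using eventually_gt_at_top[of 0] by eventually_elim (use r in \<open>simp add: real_sqrt_divide\<close>)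
  qed
qed auto

section \<open>The lower bound\<close>

lemma moser_number_density:
  assumes "c < 2 * sqrt (9 / (4 * pi))"
  shows "\<forall>\<^sub>F n in sequentially. c < real (moser_number n) * sqrt (real n) / 3 ^ n"
proof -
  define L where "L = sqrt (9 / (4 * pi))"
  have "(\<lambda>M. L + (\<Sum>u<M. L / 2 ^ Suc u)) \<longlonglongrightarrow> L + L"
  proof -
    have "(\<lambda>u. L / 2 * (1 / 2) ^ u) sums (L / 2 * 2)"
      using sums_mult[OF geometric_sums[of "1/2 :: real"], of "L / 2"] by simp
    thus ?thesis
      unfolding sums_def by (intro tendsto_intros) (simp add: power_divide)
  qed
  hence "\<forall>\<^sub>F M in sequentially. c < L + (\<Sum>u<M. L / 2 ^ Suc u)"
    by (rule order_tendstoD) (use assms in \<open>simp add: L_def\<close>)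
  then obtain M where M: "c < L + (\<Sum>u<M. L / 2 ^ Suc u)"
    by (auto simp: eventually_sequentially)
  define a where "a j n = level_size n (2 * (n div 3) + j) * sqrt (real n) / 3 ^ n" for j n
  have "(\<lambda>n. a 0 n + (\<Sum>u<M. a (2 * u + 1) n / 2 ^ Suc u)) \<longlonglongrightarrow> L + (\<Sum>u<M. L / 2 ^ Suc u)"
    unfolding a_def L_def by (intro tendsto_intros level_size_asymptotic) auto
  hence "\<forall>\<^sub>F n in sequentially. c < a 0 n + (\<Sum>u<M. a (2 * u + 1) n / 2 ^ Suc u)"
    using M by (rule order_tendstoD)
  thus ?thesis
  proof eventually_elim
    case (elim n)
    define q where "q = sqrt (real n) / 3 ^ n"
    have "a j n = q * level_size n (2 * (n div 3) + j)" for j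
      by (simp add: a_def q_def)
    hence "a 0 n + (\<Sum>u<M. a (2 * u + 1) n / 2 ^ Suc u) =
        q * (level_size n (2 * (n div 3)) + (\<Sum>u<M. level_size n (2 * (n div 3) + 2 * u + 1) / 2 ^ Suc u))"
      by (simp add: distrib_left sum_distrib_left)
    also have "\<dots> \<le> q * real (moser_number n)"
      by (intro mult_left_mono moser_number_ge_levels) (simp add: q_def)
    also have "\<dots> = real (moser_number n) * sqrt (real n) / 3 ^ n"
      by (simp add: q_def)
    finally show ?case using elim by simp
  qed
qed

text \<open>
  Taking the positive part of the deficit as error term makes the inequality hold for all
  \<open>n > 0\<close>, and a lower bound on the density is then enough for the error term to vanish.
\<close>
theorem mainTheorem5:
  shows "\<exists>\<epsilon> :: nat \<Rightarrow> real. \<epsilon> \<in> o(\<lambda>_. 1) \<and>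
    (\<forall>\<^sub>F n in sequentially.
       real (moser_number n) \<ge> (2 * sqrt (9 / (4 * pi)) - \<epsilon> n) * (3 ^ n / sqrt (real n)))"
proof -
  define c where "c = 2 * sqrt (9 / (4 * pi))"
  define \<epsilon> where "\<epsilon> n = max 0 (c - real (moser_number n) * sqrt (real n) / 3 ^ n)" for n
  have "\<epsilon> \<longlonglongrightarrow> 0"
  proof (rule tendstoI)
    fix \<delta> :: real assume "\<delta> > 0"
    hence "c - \<delta> < 2 * sqrt (9 / (4 * pi))" by (simp add: c_def)
    hence "\<forall>\<^sub>F n in sequentially. c - \<delta> < real (moser_number n) * sqrt (real n) / 3 ^ n"
      by (rule moser_number_density)
    thus "\<forall>\<^sub>F n in sequentially. dist (\<epsilon> n) 0 < \<delta>"
    proof eventually_elim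
      case (elim n)
      hence "0 \<le> \<epsilon> n" "\<epsilon> n < \<delta>" using \<open>\<delta> > 0\<close> by (simp_all add: \<epsilon>_def)
      thus ?case by simp
    qed
  qed
  hence "\<epsilon> \<in> o(\<lambda>_. 1)" by (intro smalloI_tendsto) auto
  moreover have "\<forall>\<^sub>F n in sequentially. real (moser_number n) \<ge> (c - \<epsilon> n) * (3 ^ n / sqrt (real n))"
    using eventually_gt_at_top[of 0]
  proof eventually_elim
    case (elim n)
    have "c - \<epsilon> n \<le> real (moser_number n) * sqrt (real n) / 3 ^ n" by (simp add: \<epsilon>_def)
    thus ?case using elim by (simp add: field_simps)
  qed
  ultimately show ?thesis unfolding c_def by (intro exI[of _ \<epsilon>] conjI)
qed

end
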